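(* Let $I\subset\mathbb{N}$, let $X_i$ ($i\in I$) be random variables following a known distribution, with PDFs $f_{X_i}$, and let $Y$ be a random variable whose PDF is $$f_Y(t)=\sum_{i\in I}A_i f_{X_i}(t),$$ where $A_i\in\mathbb{R}$ and $\sum_{i\in I}A_i=1$. Then the moment generating function of $Y$ is $$\Phi_Y(t)=\sum_{i\in I}A_i\Phi_{X_i}(t).$$
   Context: "PDF" means probability density function in the continuous case and probability mass function in the discrete case; both cases are covered. $\Phi_X$ denotes the moment generating function of $X$, i.e. $\Phi_X(t)=\int_{-\infty}^{+\infty}e^{tx}f_X(x)\,dx$ in the continuous case and $\Phi_X(t)=\sum_{j}e^{tx_j}f_X(x_j)$ in the discrete case. The coefficients $A_i$ may be negative.
   Formalization: The formula is proved at each t where every moment generating function of X_i is finite and the sum of A_i times these converges unconditionally (automatic for finite I); sums over infinite I are unconditional. Without this the claim can fail for infinite I. *)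

theory Defs
  imports "HOL-Probability.Probability"
begin

datatype rv_kind = Continuous | Discrete

text \<open>
  A real-valued function \<open>f\<close> is a PDF of \<open>X\<close>: a nonnegative density with respect to Lebesgue
  measure in the continuous case, the probability mass function in the discrete case.
\<close>

fun has_pdf :: "rv_kind \<Rightarrow> 'a measure \<Rightarrow> ('a \<Rightarrow> real) \<Rightarrow> (real \<Rightarrow> real) \<Rightarrow> bool" where
  "has_pdf Continuous M X f \<longleftrightarrow>
     (\<forall>x. 0 \<le> f x) \<and> distributed M lborel X (\<lambda>x. ennreal (f x))"
| "has_pdf Discrete M X f \<longleftrightarrow>
     X \<in> borel_measurable M \<and>
     (\<exists>S. countable S \<and> (AE \<omega> in M. X \<omega> \<in> S)) \<and>
     (\<forall>x. f x = measure M {\<omega> \<in> space M. X \<omega> = x})"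

text \<open>
  The moment generating function of a random variable with PDF \<open>f\<close>. In the discrete case the
  points \<open>x\<^sub>j\<close> are the atoms, i.e. the points where \<open>f\<close> does not vanish. The values below are
  meaningful only where \<open>mgf_exists\<close> holds; elsewhere both the integral and the infinite
  sum default to \<open>0\<close>.
\<close>

fun mgf_exists :: "rv_kind \<Rightarrow> (real \<Rightarrow> real) \<Rightarrow> real \<Rightarrow> bool" where
  "mgf_exists Continuous f t \<longleftrightarrow> integrable lborel (\<lambda>x. exp (t * x) * f x)"
| "mgf_exists Discrete f t \<longleftrightarrow> (\<lambda>x. exp (t * x) * f x) summable_on {x. f x \<noteq> 0}"

fun mgf :: "rv_kind \<Rightarrow> (real \<Rightarrow> real) \<Rightarrow> real \<Rightarrow> real" where
  "mgf Continuous f t = (\<integral>x. exp (t * x) * f x \<partial>lborel)"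
| "mgf Discrete f t = (\<Sum>\<^sub>\<infinity>x\<in>{x. f x \<noteq> 0}. exp (t * x) * f x)"

end

theory Submission
  imports Defs
begin

text \<open>
  Convergence of \<open>\<Sum>\<^sub>i A\<^sub>i \<Phi>\<^sub>i(t)\<close> over the index set is unconditional, hence absolute. Since
  \<open>\<Phi>\<^sub>i(t)\<close> is the integral of a nonnegative function, \<open>\<Sum>\<^sub>i \<integral> \<bar>A\<^sub>i e\<^sup>t\<^sup>x f\<^sub>i(x)\<bar> dx\<close> is finite even when
  the \<open>A\<^sub>i\<close> have mixed signs, and summation commutes with integration. The discrete case is the same
  argument for the counting measure.
\<close>

text \<open>Term-by-term integration, by dominated convergence for series: the finite total of the
  L1 norms supplies the dominating function. A \<open>nat\<close> index set lets the unordered sum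
  be read as an ordinary series.\<close>

lemma integral_has_sum_nat:
  fixes F :: "nat \<Rightarrow> 'a \<Rightarrow> real" and h :: "'a \<Rightarrow> real"
  assumes int: "\<And>i. i \<in> I \<Longrightarrow> integrable \<mu> (F i)"
    and abs_summable: "(\<lambda>i. \<integral>x. \<bar>F i x\<bar> \<partial>\<mu>) summable_on I"
    and h: "\<And>x. ((\<lambda>i. F i x) has_sum h x) I"
  shows "integrable \<mu> h" and "((\<lambda>i. \<integral>x. F i x \<partial>\<mu>) has_sum (\<integral>x. h x \<partial>\<mu>)) I"
proof -
  \<comment> \<open>Extension by zero off \<open>I\<close>, so that the family becomes a series
    indexed by all of \<open>nat\<close>.\<close>
  define G where "G i = (if i \<in> I then F i else (\<lambda>x. 0))" for i
  have int_G: "integrable \<mu> (G i)" for i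
    using int unfolding G_def by (cases "i \<in> I") simp_all
  \<comment> \<open>Used for three functionals that vanish at the zero function: evaluation at a
    point, the L1 norm and the integral.\<close>
  have has_sum_G_iff:
    "((\<lambda>i. \<phi> (G i)) has_sum s) UNIV \<longleftrightarrow> ((\<lambda>i. \<phi> (F i)) has_sum s) I"
    if "\<phi> (\<lambda>x. 0) = 0" for \<phi> :: "('a \<Rightarrow> real) \<Rightarrow> real" and s
    by (rule has_sum_cong_neutral) (simp_all add: G_def that)
  have has_sum_G: "((\<lambda>i. G i x) has_sum h x) UNIV" for x
    using h[of x] has_sum_G_iff[of "\<lambda>f. f x"] by simp
  have pointwise: "summable (\<lambda>i. norm (G i x))" for x
    by (intro summable_on_imp_summable summable_on_iff_abs_summable_on_real[THEN iffD1]
        has_sum_imp_summable[OF has_sum_G])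
  have "(\<lambda>i. \<integral>x. norm (G i x) \<partial>\<mu>) summable_on UNIV"
    using abs_summable has_sum_G_iff[of "\<lambda>f. \<integral>x. \<bar>f x\<bar> \<partial>\<mu>"] by (simp add: summable_on_def)
  then have norms: "summable (\<lambda>i. \<integral>x. norm (G i x) \<partial>\<mu>)"
    by (rule summable_on_imp_summable)
  have h_eq: "h = (\<lambda>x. \<Sum>i. G i x)"
    using has_sum_imp_sums[OF has_sum_G] by (auto simp: sums_iff)
  show "integrable \<mu> h"
    unfolding h_eq using int_G pointwise norms by (intro integrable_suminf) auto
  have sums: "(\<lambda>i. \<integral>x. G i x \<partial>\<mu>) sums (\<integral>x. h x \<partial>\<mu>)"
    unfolding h_eq using int_G pointwise norms by (intro sums_integral) auto
  \<comment> \<open>\<open>sums\<close> only records convergence in the natural order; absolute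
    convergence makes it unconditional again.\<close>
  have "summable (\<lambda>i. norm (\<integral>x. G i x \<partial>\<mu>))"
    by (rule summable_comparison_test'[OF norms]) simp
  then have "((\<lambda>i. \<integral>x. G i x \<partial>\<mu>) has_sum (\<integral>x. h x \<partial>\<mu>)) UNIV"
    using sums by (rule norm_summable_imp_has_sum)
  then show "((\<lambda>i. \<integral>x. F i x \<partial>\<mu>) has_sum (\<integral>x. h x \<partial>\<mu>)) I"
    using has_sum_G_iff[of "\<lambda>f. \<integral>x. f x \<partial>\<mu>"] by simp
qed

lemma integrable_count_space_iff_summable_on:
  fixes f :: "'a \<Rightarrow> real"
  shows "integrable (count_space A) f \<longleftrightarrow> f summable_on A"
  using summable_on_iff_abs_summable_on_real[of f A] abs_summable_equivalent[of f A]
  unfolding Infinite_Set_Sum.abs_summable_on_def by blast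

lemma integral_count_space_eq_infsum:
  fixes f :: "'a \<Rightarrow> real"
  shows "(\<integral>x. f x \<partial>count_space A) = infsum f A"
proof (cases "f summable_on A")
  case True
  then show ?thesis
    using infsetsum_infsum[of f A]
    by (simp add: integrable_count_space_iff_summable_on infsetsum_def
        Infinite_Set_Sum.abs_summable_on_def)
next
  case False
  \<comment> \<open>Without summability both sides take the default value 0.\<close>
  then show ?thesis
    by (simp add: integrable_count_space_iff_summable_on not_integrable_integral_eq
        infsum_not_exists)
qed

text \<open>Counting measure lives on all of \<open>UNIV\<close>, not on the atoms of one PDF, so
  that every \<open>fX i\<close> and \<open>fY\<close> are integrated against the same measure
  although their atoms may differ.\<close>

fun reference_measure :: "rv_kind \<Rightarrow> real measure" where
  "reference_measure Continuous = lborel"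
| "reference_measure Discrete = count_space UNIV"

text \<open>In the discrete case, points with \<open>f x = 0\<close> contribute zero terms, so the
  sum over the atoms extends to all reals.\<close>

lemma mgf_exists_iff_integrable:
  "mgf_exists k f t \<longleftrightarrow> integrable (reference_measure k) (\<lambda>x. exp (t * x) * f x)"
proof (cases k)
  case Discrete
  have "(\<lambda>x. exp (t * x) * f x) summable_on {x. f x \<noteq> 0} \<longleftrightarrow>
      (\<lambda>x. exp (t * x) * f x) summable_on UNIV"
    by (rule summable_on_cong_neutral) auto
  with Discrete show ?thesis
    by (simp add: integrable_count_space_iff_summable_on)
qed simp

lemma mgf_eq_integral: "mgf k f t = (\<integral>x. exp (t * x) * f x \<partial>reference_measure k)"
proof (cases k)
  case Discrete
  have "infsum (\<lambda>x. exp (t * x) * f x) {x. f x \<noteq> 0} = infsum (\<lambda>x. exp (t * x) * f x) UNIV"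
    by (rule infsum_cong_neutral) auto
  with Discrete show ?thesis
    by (simp add: integral_count_space_eq_infsum)
qed simp

lemma has_pdf_nonneg: "has_pdf k M X f \<Longrightarrow> 0 \<le> f x"
  by (cases k) simp_all

theorem theorem4:
  fixes k :: rv_kind
    and I :: "nat set"
    and M :: "nat \<Rightarrow> 'a measure" and X :: "nat \<Rightarrow> 'a \<Rightarrow> real" and fX :: "nat \<Rightarrow> real \<Rightarrow> real"
    and N :: "'b measure" and Y :: "'b \<Rightarrow> real" and fY :: "real \<Rightarrow> real"
    and A :: "nat \<Rightarrow> real" and t :: real
  assumes "\<And>i. i \<in> I \<Longrightarrow> prob_space (M i)"
    and "\<And>i. i \<in> I \<Longrightarrow> has_pdf k (M i) (X i) (fX i)"
    and "prob_space N"
    and "has_pdf k N Y fY"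
    and "\<And>x. ((\<lambda>i. A i * fX i x) has_sum fY x) I"
    and "(A has_sum 1) I"
    and "\<And>i. i \<in> I \<Longrightarrow> mgf_exists k (fX i) t"
    and "(\<lambda>i. A i * mgf k (fX i) t) summable_on I"
  shows "mgf_exists k fY t \<and> mgf k fY t = (\<Sum>\<^sub>\<infinity>i\<in>I. A i * mgf k (fX i) t)"
proof -
  let ?\<mu> = "reference_measure k"
  let ?F = "\<lambda>i x. A i * (exp (t * x) * fX i x)"
  have int: "integrable ?\<mu> (?F i)" if "i \<in> I" for i
    using assms(7)[OF that] by (simp add: mgf_exists_iff_integrable)
  have "(\<lambda>i. \<bar>A i * mgf k (fX i) t\<bar>) summable_on I"
    using assms(8) summable_on_iff_abs_summable_on_real by fastforce
  \<comment> \<open>The factor \<open>exp (t * x) * fX i x\<close> is nonnegative, so the absolute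
    value affects only the constant \<open>A i\<close> and passes outside the integral.\<close>
  moreover have "(\<integral>x. \<bar>?F i x\<bar> \<partial>?\<mu>) = \<bar>A i * mgf k (fX i) t\<bar>" if "i \<in> I" for i
    using has_pdf_nonneg[OF assms(2)[OF that]] by (simp add: mgf_eq_integral abs_mult)
  ultimately have abs_summable: "(\<lambda>i. \<integral>x. \<bar>?F i x\<bar> \<partial>?\<mu>) summable_on I"
    by (simp cong: summable_on_cong)
  have pointwise: "((\<lambda>i. ?F i x) has_sum exp (t * x) * fY x) I" for x
    using has_sum_cmult_right[OF assms(5)[of x], of "exp (t * x)"] by (simp add: ac_simps)
  have "mgf_exists k fY t"
    unfolding mgf_exists_iff_integrable
    using integral_has_sum_nat(1)[OF int abs_summable pointwise] by simp
  moreover have "((\<lambda>i. A i * mgf k (fX i) t) has_sum mgf k fY t) I"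
    using integral_has_sum_nat(2)[OF int abs_summable pointwise] by (simp add: mgf_eq_integral)
  ultimately show ?thesis
    by (simp add: infsumI)
qed

end
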